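(* Let $A$ be a finite-dimensional complex Hilbert space. For any non-commutative graph $S\subseteq\mathcal{L}(A)$, $$\widetilde{\alpha}(S)\le\widetilde{\vartheta}(S).$$ Furthermore, $\widetilde{\vartheta}$ is monotonic with respect to subgraphs: if $S\subseteq S'$ are two non-commutative graphs in $\mathcal{L}(A)$, then $\widetilde{\vartheta}(S)\ge\widetilde{\vartheta}(S')$.
   Context: All Hilbert spaces are finite-dimensional and complex; $\mathcal{L}(A)$ is the space of linear operators on $A$; a state on $A$ is a positive semidefinite operator of trace $1$, and $\mathcal{S}(A)$ is the set of states. A non-commutative graph is a linear subspace $S\subseteq\mathcal{L}(A)$ with $\mathbf{1}\in S$ and $S=S^\dagger$. $\perp$ denotes orthogonality with respect to the Hilbert-Schmidt inner product $\operatorname{Tr}X^\dagger Y$. $\|\cdot\|$ is the operator norm. Entanglement-assisted independence number: $\widetilde{\alpha}(S)$ is the largest integer $N$ such that there exist a Hilbert space $R$, a state $\rho\in\mathcal{S}(A\otimes R)$ and unitaries $U_1,\dots,U_N$ on $A\otimes R$ such that for all $m\ne m'$, $U_m\rho U_{m'}^\dagger\perp S\otimes\mathcal{L}(R)$. Define $\vartheta(S):=\max\{\|\mathbf{1}+T\|: T\in S^\perp,\ \mathbf{1}+T\ge 0\}$, and the quantum Lovász function $$\widetilde{\vartheta}(S):=\sup_{n\in\mathbb{N}}\vartheta\bigl(S\otimes\mathcal{L}(\mathbb{C}^n)\bigr)=\sup_n\max\{\|\mathbf{1}+T\|: T\in S^\perp\otimes\mathcal{L}(\mathbb{C}^n),\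 \mathbf{1}+T\ge 0\}.$$ *)

theory Defs
  imports
    "Jordan_Normal_Form.Schur_Decomposition"
    "Jordan_Normal_Form.VS_Connect"
    "HOL-Library.Extended_Real"
begin

text \<open>
  A Hilbert space of dimension \<open>d\<close> is \<open>\<complex>\<^sup>d\<close> with its standard inner product,
  and its operators are \<open>carrier_mat d d\<close>. The tensor product of
  \<open>\<complex>\<^sup>d\<close> and \<open>\<complex>\<^sup>r\<close> is \<open>\<complex>\<^sup>d\<^sup>r\<close>, the basis vector \<open>e\<^sub>i \<otimes> e\<^sub>j\<close> having index \<open>i * r + j\<close>.
\<close>

definition kron :: "complex mat \<Rightarrow> complex mat \<Rightarrow> complex mat" where
  "kron X Y = mat (dim_row X * dim_row Y) (dim_col X * dim_col Y)
     (\<lambda>(i, j). X $$ (i div dim_row Y, j div dim_col Y) * Y $$ (i mod dim_row Y, j mod dim_col Y))"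

definition mat_trace :: "complex mat \<Rightarrow> complex" where
  "mat_trace X = (\<Sum>i<dim_row X. X $$ (i, i))"

definition hs_inner :: "complex mat \<Rightarrow> complex mat \<Rightarrow> complex" where
  "hs_inner X Y = mat_trace (mat_adjoint X * Y)"

definition hs_perp :: "nat \<Rightarrow> complex mat set \<Rightarrow> complex mat set" where
  "hs_perp d S = {T \<in> carrier_mat d d. \<forall>X\<in>S. hs_inner X T = 0}"

text \<open>\<open>0 \<le> z\<close> for complex \<open>z\<close> means that \<open>z\<close> is real and nonnegative, so
  Hermiticity is part of the following condition.\<close>

definition psd :: "nat \<Rightarrow> complex mat \<Rightarrow> bool" where
  "psd d X \<longleftrightarrow> X \<in> carrier_mat d d \<and> (\<forall>v\<in>carrier_vec d. 0 \<le> (X *\<^sub>v v) \<bullet>c v)"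

definition density_op :: "nat \<Rightarrow> complex mat \<Rightarrow> bool" where
  "density_op d \<rho> \<longleftrightarrow> psd d \<rho> \<and> mat_trace \<rho> = 1"

definition unitary_mat :: "nat \<Rightarrow> complex mat \<Rightarrow> bool" where
  "unitary_mat d U \<longleftrightarrow> U \<in> carrier_mat d d \<and>
     mat_adjoint U * U = 1\<^sub>m d \<and> U * mat_adjoint U = 1\<^sub>m d"

definition vec_norm2 :: "complex vec \<Rightarrow> real" where
  "vec_norm2 v = sqrt (Re (v \<bullet>c v))"

definition op_norm :: "complex mat \<Rightarrow> real" where
  "op_norm X = (SUP v\<in>{v \<in> carrier_vec (dim_col X). vec_norm2 v \<le> 1}. vec_norm2 (X *\<^sub>v v))"

definition nc_graph :: "nat \<Rightarrow> complex mat set \<Rightarrow> bool" where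
  "nc_graph d S \<longleftrightarrow> VectorSpace.subspace class_ring S (module_mat TYPE(complex) d d) \<and>
     1\<^sub>m d \<in> S \<and> mat_adjoint ` S = S"

text \<open>\<open>S \<otimes> \<L>(\<complex>\<^sup>n)\<close> inside \<open>\<L>(\<complex>\<^sup>d \<otimes> \<complex>\<^sup>n)\<close>, for \<open>S \<subseteq> \<L>(\<complex>\<^sup>d)\<close>.\<close>

definition tensor_full :: "nat \<Rightarrow> complex mat set \<Rightarrow> nat \<Rightarrow> complex mat set" where
  "tensor_full d S n =
     LinearCombinations.module.span class_ring (module_mat TYPE(complex) (d * n) (d * n))
       {kron X Y | X Y. X \<in> S \<and> Y \<in> carrier_mat n n}"

text \<open>The auxiliary Hilbert space \<open>R\<close> is \<open>\<complex>\<^sup>r\<close>.\<close>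

definition ea_independent :: "nat \<Rightarrow> complex mat set \<Rightarrow> nat \<Rightarrow> bool" where
  "ea_independent d S N \<longleftrightarrow>
     (\<exists>r \<rho> (U :: nat \<Rightarrow> complex mat).
        density_op (d * r) \<rho> \<and>
        (\<forall>m<N. unitary_mat (d * r) (U m)) \<and>
        (\<forall>m<N. \<forall>m'<N. m \<noteq> m' \<longrightarrow>
           U m * \<rho> * mat_adjoint (U m') \<in> hs_perp (d * r) (tensor_full d S r)))"

text \<open>In \<open>enat\<close> the supremum of a finite nonempty set is its maximum, and that of an
  infinite set is \<open>\<infinity>\<close>; hence this is the largest admissible \<open>N\<close>.\<close>

definition alpha_ea :: "nat \<Rightarrow> complex mat set \<Rightarrow> enat" where
  "alpha_ea d S = Sup {enat N | N. ea_independent d S N}"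

text \<open>A supremum in \<open>ereal\<close> stands for the maximum. For \<open>1\<^sub>m d \<in> S\<close> the admissible \<open>T\<close> are
  traceless with \<open>1\<^sub>m d + T \<ge> 0\<close>, so they form a compact set and the supremum is attained.\<close>

definition theta :: "nat \<Rightarrow> complex mat set \<Rightarrow> ereal" where
  "theta d S = (SUP T\<in>{T \<in> hs_perp d S. psd d (1\<^sub>m d + T)}. ereal (op_norm (1\<^sub>m d + T)))"

definition theta_quantum :: "nat \<Rightarrow> complex mat set \<Rightarrow> ereal" where
  "theta_quantum d S = (SUP n\<in>{1..}. theta (d * n) (tensor_full d S n))"

end

theory Submission
  imports Defs "HOL-Analysis.L2_Norm"
begin

text \<open>
  Let \<open>\<rho>\<close> and \<open>U\<^sub>1, \<dots>, U\<^sub>N\<close> witness the value \<open>N\<close>, and put \<open>R = \<rho> / l\<close> for the largest eigenvalue \<open>l\<close>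
  of \<open>\<rho>\<close>, so \<open>0 \<le> R \<le> 1\<close>. With an extra factor \<open>\<complex>\<^sup>N\<close>, the operator
  \<open>T = \<Sum>\<^bsub>m \<noteq> m'\<^esub> U\<^sub>m R U\<^sub>m\<^sub>'\<^sup>\<dagger> \<otimes> |m\<rangle>\<langle>m'|\<close> is orthogonal to \<open>S \<otimes> \<L>(\<complex>\<^sup>r \<otimes> \<complex>\<^sup>N)\<close>. Conjugating by the block
  diagonal unitary with blocks \<open>U\<^sub>m\<close> turns \<open>1 + T\<close> into \<open>(1 - R) \<otimes> 1 + R \<otimes> J\<close> with \<open>J\<close> the all-ones
  matrix, which is positive and has norm \<open>N\<close>. Monotonicity holds since \<open>\<perp>\<close> reverses inclusions.
\<close>

section \<open>Sesquilinear forms\<close>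

text \<open>Indices are written \<open>p * N + m\<close> and collected by the residue
  \<open>m\<close>, so that the sum over the second tensor factor comes outermost.\<close>

lemma sum_nat_blocks:
  fixes f :: "nat \<Rightarrow> 'a :: comm_monoid_add"
  shows "(\<Sum>i<D * N. f i) = (\<Sum>m<N. \<Sum>p<D. f (p * N + m))"
proof -
  have "(\<Sum>i<D * N. f i) = (\<Sum>p<D. sum f {p * N..<p * N + N})"
    by (simp add: sum.nat_group)
  also have "\<dots> = (\<Sum>p<D. \<Sum>m<N. f (p * N + m))"
  proof (rule sum.cong[OF refl])
    fix p
    have "sum f {0 + p * N..<N + p * N} = (\<Sum>m = 0..<N. f (m + p * N))"
      by (rule sum.shift_bounds_nat_ivl)
    then show "sum f {p * N..<p * N + N} = (\<Sum>m<N. f (p * N + m))"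
      by (simp add: add.commute atLeast0LessThan)
  qed
  also have "\<dots> = (\<Sum>m<N. \<Sum>p<D. f (p * N + m))"
    by (rule sum.swap)
  finally show ?thesis .
qed

lemma cscalar_prod_sum:
  fixes v :: "complex vec"
  assumes "v \<in> carrier_vec n"
  shows "u \<bullet>c v = (\<Sum>i<n. u $ i * cnj (v $ i))"
  using assms by (auto simp: scalar_prod_def atLeast0LessThan)

lemma mult_mat_vec_sum:
  assumes "A \<in> carrier_mat n k" "u \<in> carrier_vec k" "i < n"
  shows "(A *\<^sub>v u) $ i = (\<Sum>j<k. A $$ (i, j) * u $ j)"
  using assms by (auto simp: scalar_prod_def atLeast0LessThan)

lemma form_sum:
  fixes A :: "complex mat"
  assumes "A \<in> carrier_mat n k" "u \<in> carrier_vec k" "v \<in> carrier_vec n"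
  shows "(A *\<^sub>v u) \<bullet>c v = (\<Sum>i<n. \<Sum>j<k. A $$ (i, j) * u $ j * cnj (v $ i))"
  by (simp add: cscalar_prod_sum[OF assms(3)] mult_mat_vec_sum[OF assms(1,2)] sum_distrib_right
      del: index_mult_mat_vec)

lemma mat_adjoint_carrier [simp]:
  "A \<in> carrier_mat n k \<Longrightarrow> mat_adjoint A \<in> carrier_mat k n"
  unfolding mat_adjoint_def by auto

lemma mat_adjoint_index:
  fixes A :: "complex mat"
  assumes "A \<in> carrier_mat n k" "i < k" "j < n"
  shows "mat_adjoint A $$ (i, j) = cnj (A $$ (j, i))"
  using assms unfolding mat_adjoint_def by (auto simp: mat_of_rows_index)

lemma form_adjoint:
  fixes A :: "complex mat"
  assumes "A \<in> carrier_mat n k" "u \<in> carrier_vec k" "v \<in> carrier_vec n"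
  shows "(A *\<^sub>v u) \<bullet>c v = u \<bullet>c (mat_adjoint A *\<^sub>v v)"
proof -
  have "mat_adjoint A *\<^sub>v v \<in> carrier_vec k"
    using assms mat_adjoint_carrier mult_mat_vec_carrier by blast
  then have "u \<bullet>c (mat_adjoint A *\<^sub>v v) = (\<Sum>j<k. \<Sum>i<n. A $$ (i, j) * u $ j * cnj (v $ i))"
    using assms
    by (simp add: cscalar_prod_sum mult_mat_vec_sum[OF mat_adjoint_carrier[OF assms(1)] assms(3)]
        mat_adjoint_index[OF assms(1)] sum_distrib_left mult_ac del: index_mult_mat_vec)
  also have "\<dots> = (A *\<^sub>v u) \<bullet>c v"
    unfolding form_sum[OF assms] by (rule sum.swap)
  finally show ?thesis ..
qed

lemma form_smult_mat:
  fixes A :: "complex mat"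
  assumes "A \<in> carrier_mat n k" "u \<in> carrier_vec k" "v \<in> carrier_vec n"
  shows "((c \<cdot>\<^sub>m A) *\<^sub>v u) \<bullet>c v = c * ((A *\<^sub>v u) \<bullet>c v)"
  unfolding form_sum[OF smult_carrier_mat[OF assms(1)] assms(2,3)] form_sum[OF assms]
  using assms by (simp add: sum_distrib_left mult_ac)

lemma form_smult_vec:
  fixes A :: "complex mat"
  assumes "A \<in> carrier_mat n n" "u \<in> carrier_vec n"
  shows "(A *\<^sub>v (c \<cdot>\<^sub>v u)) \<bullet>c (c \<cdot>\<^sub>v u) = c * cnj c * ((A *\<^sub>v u) \<bullet>c u)"
  using assms by (simp add: form_sum sum_distrib_left mult_ac)

lemma cscalar_prod_smult:
  fixes u :: "complex vec"
  assumes "u \<in> carrier_vec n"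
  shows "(c \<cdot>\<^sub>v u) \<bullet>c (c \<cdot>\<^sub>v u) = c * cnj c * (u \<bullet>c u)"
  using assms by (simp add: cscalar_prod_sum sum_distrib_left mult_ac)

text \<open>Later folds the \<open>N * N\<close> terms of a block form into one form at the sum of
  the \<open>y m\<close>. The right side stays at the level of entries, so nothing is assumed about
  the dimension of \<open>y m\<close>.\<close>

lemma form_sum_vec:
  fixes A :: "complex mat"
  assumes A: "A \<in> carrier_mat n n"
  shows "(A *\<^sub>v vec n (\<lambda>p. \<Sum>m<N. y m $ p)) \<bullet>c vec n (\<lambda>p. \<Sum>m<N. y m $ p)
    = (\<Sum>m<N. \<Sum>m'<N. \<Sum>i<n. \<Sum>j<n. A $$ (i, j) * y m' $ j * cnj (y m $ i))"
proof -
  have "(A *\<^sub>v vec n (\<lambda>p. \<Sum>m<N. y m $ p)) \<bullet>c vec n (\<lambda>p. \<Sum>m<N. y m $ p)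
    = (\<Sum>i<n. \<Sum>j<n. \<Sum>m<N. \<Sum>m'<N. A $$ (i, j) * y m' $ j * cnj (y m $ i))"
    unfolding form_sum[OF A vec_carrier vec_carrier]
    by (intro sum.cong refl) (simp add: sum_product mult_ac sum_distrib_left, rule sum.swap)
  also have "\<dots> = (\<Sum>i<n. \<Sum>m<N. \<Sum>m'<N. \<Sum>j<n. A $$ (i, j) * y m' $ j * cnj (y m $ i))"
    by (intro sum.cong refl, subst sum.swap, intro sum.cong refl, rule sum.swap)
  also have "\<dots> = (\<Sum>m<N. \<Sum>m'<N. \<Sum>i<n. \<Sum>j<n. A $$ (i, j) * y m' $ j * cnj (y m $ i))"
    by (subst sum.swap, intro sum.cong refl, rule sum.swap)
  finally show ?thesis .
qed

section \<open>Norms\<close>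

lemma vec_norm2_L2_set:
  assumes "v \<in> carrier_vec n"
  shows "vec_norm2 v = L2_set (\<lambda>i. cmod (v $ i)) {..<n}"
  unfolding vec_norm2_def L2_set_def cscalar_prod_sum[OF assms]
  by (simp add: complex_norm_square[symmetric] flip: of_real_power)

lemma cscalar_prod_self:
  assumes "v \<in> carrier_vec n"
  shows "v \<bullet>c v = of_real ((vec_norm2 v)\<^sup>2)"
proof -
  have "v \<bullet>c v = of_real (\<Sum>i<n. (cmod (v $ i))\<^sup>2)"
    unfolding cscalar_prod_sum[OF assms] by (simp add: complex_norm_square[symmetric])
  then show ?thesis
    by (simp add: vec_norm2_L2_set[OF assms] L2_set_def sum_nonneg)
qed

lemma vec_norm2_nonneg: "v \<in> carrier_vec n \<Longrightarrow> 0 \<le> vec_norm2 v"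
  by (simp add: vec_norm2_L2_set L2_set_nonneg)

lemma Re_cscalar_prod_le:
  assumes "u \<in> carrier_vec n" "v \<in> carrier_vec n"
  shows "Re (u \<bullet>c v) \<le> vec_norm2 u * vec_norm2 v"
proof -
  have "Re (u \<bullet>c v) \<le> cmod (u \<bullet>c v)"
    by (rule complex_Re_le_cmod)
  also have "\<dots> \<le> (\<Sum>i<n. \<bar>cmod (u $ i)\<bar> * \<bar>cmod (v $ i)\<bar>)"
    unfolding cscalar_prod_sum[OF assms(2)]
    by (rule order.trans[OF norm_sum]) (simp add: norm_mult)
  also have "\<dots> \<le> vec_norm2 u * vec_norm2 v"
    unfolding vec_norm2_L2_set[OF assms(1)] vec_norm2_L2_set[OF assms(2)]
    by (rule L2_set_mult_ineq)
  finally show ?thesis .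
qed

text \<open>A crude bound that serves to make the supremum in \<open>op_norm\<close> bounded above.
  Coordinates of \<open>v\<close> have modulus at most 1, and the L2 norm of the image is at most
  its L1 norm.\<close>

lemma vec_norm2_mult_mat_vec_le:
  assumes A: "A \<in> carrier_mat n k" and v: "v \<in> carrier_vec k" and "vec_norm2 v \<le> 1"
  shows "vec_norm2 (A *\<^sub>v v) \<le> (\<Sum>i<n. \<Sum>j<k. cmod (A $$ (i, j)))"
proof -
  have "cmod (v $ j) \<le> 1" if "j < k" for j
    using member_le_L2_set[of "{..<k}" j "\<lambda>i. cmod (v $ i)"] that assms
    by (simp add: vec_norm2_L2_set[OF v])
  then have le: "cmod ((A *\<^sub>v v) $ i) \<le> (\<Sum>j<k. cmod (A $$ (i, j)))" if "i < n" for i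
    unfolding mult_mat_vec_sum[OF A v that]
    by (intro order.trans[OF norm_sum] sum_mono) (simp add: norm_mult mult_left_le)
  have "vec_norm2 (A *\<^sub>v v) \<le> (\<Sum>i<n. cmod ((A *\<^sub>v v) $ i))"
    unfolding vec_norm2_L2_set[OF mult_mat_vec_carrier[OF A v]]
    by (rule L2_set_le_sum) simp
  also have "\<dots> \<le> (\<Sum>i<n. \<Sum>j<k. cmod (A $$ (i, j)))"
    using le by (intro sum_mono) auto
  finally show ?thesis .
qed

lemma vec_norm2_le_op_norm:
  assumes A: "A \<in> carrier_mat n k" and v: "v \<in> carrier_vec k" "vec_norm2 v \<le> 1"
  shows "vec_norm2 (A *\<^sub>v v) \<le> op_norm A"
  unfolding op_norm_def
  using A v
  by (intro cSUP_upper bdd_aboveI2[where M = "\<Sum>i<n. \<Sum>j<k. cmod (A $$ (i, j))"])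
     (auto intro: vec_norm2_mult_mat_vec_le)

text \<open>Normalise \<open>v\<close> and apply Cauchy-Schwarz. This turns test vectors into lower
  bounds for \<open>op_norm\<close>.\<close>

lemma Rayleigh_quotient_le_op_norm:
  assumes A: "A \<in> carrier_mat n n" and v: "v \<in> carrier_vec n" and "vec_norm2 v > 0"
  shows "Re ((A *\<^sub>v v) \<bullet>c v) \<le> op_norm A * (vec_norm2 v)\<^sup>2"
proof -
  let ?c = "complex_of_real (1 / vec_norm2 v)"
  let ?u = "?c \<cdot>\<^sub>v v"
  have u: "?u \<in> carrier_vec n"
    using v by simp
  have "?u \<bullet>c ?u = 1"
    using assms(3) unfolding cscalar_prod_smult[OF v] cscalar_prod_self[OF v]
    by (simp add: power2_eq_square)
  then have n: "vec_norm2 ?u = 1"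
    unfolding vec_norm2_def by simp
  have "Re ((A *\<^sub>v ?u) \<bullet>c ?u) \<le> vec_norm2 (A *\<^sub>v ?u) * vec_norm2 ?u"
    using A u by (intro Re_cscalar_prod_le) auto
  also have "\<dots> \<le> op_norm A"
    using vec_norm2_le_op_norm[OF A u] n by simp
  finally have "Re (?c * cnj ?c * ((A *\<^sub>v v) \<bullet>c v)) \<le> op_norm A"
    unfolding form_smult_vec[OF A v] .
  moreover have "?c * cnj ?c = of_real (1 / (vec_norm2 v)\<^sup>2)"
    by (simp add: power2_eq_square)
  ultimately have "Re ((A *\<^sub>v v) \<bullet>c v) / (vec_norm2 v)\<^sup>2 \<le> op_norm A"
    by (simp only: times_complex.sel Re_complex_of_real Im_complex_of_real) simp
  then show ?thesis
    using assms(3) by (simp add: field_simps)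
qed

section \<open>Hilbert-Schmidt orthogonality\<close>

lemma hs_inner_sum:
  assumes "X \<in> carrier_mat n n" "Y \<in> carrier_mat n n"
  shows "hs_inner X Y = (\<Sum>i<n. \<Sum>j<n. cnj (X $$ (i, j)) * Y $$ (i, j))"
proof -
  have "hs_inner X Y = (\<Sum>j<n. \<Sum>i<n. cnj (X $$ (i, j)) * Y $$ (i, j))"
    unfolding hs_inner_def mat_trace_def
    using assms carrier_matD[OF mat_adjoint_carrier[OF assms(1)]]
    by (simp add: scalar_prod_def atLeast0LessThan mat_adjoint_index[OF assms(1)])
  also have "\<dots> = (\<Sum>i<n. \<Sum>j<n. cnj (X $$ (i, j)) * Y $$ (i, j))"
    by (rule sum.swap)
  finally show ?thesis .
qed

text \<open>The \<open>X\<close> with \<open>hs_inner X T = 0\<close> form a subspace, the inner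
  product being conjugate-linear in \<open>X\<close>. Orthogonality to \<open>tensor_full\<close>
  thereby reduces to the generators \<open>kron X Y\<close>.\<close>

lemma hs_perp_spanI:
  assumes T: "T \<in> carrier_mat n n" and G: "G \<subseteq> carrier_mat n n"
    and "\<And>X. X \<in> G \<Longrightarrow> hs_inner X T = 0"
  shows "T \<in> hs_perp n (LinearCombinations.module.span class_ring (module_mat TYPE(complex) n n) G)"
proof -
  interpret matrix_vs n n "TYPE(complex)" .
  let ?N = "{X \<in> carrier_mat n n. hs_inner X T = 0}"
  have "submodule class_ring ?N V"
  proof (unfold_locales)
    fix X Y assume "X \<in> ?N" "Y \<in> ?N"
    then have XY: "X \<in> carrier_mat n n" "Y \<in> carrier_mat n n"
        "hs_inner X T = 0" "hs_inner Y T = 0"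
      by auto
    have "hs_inner (X + Y) T = hs_inner X T + hs_inner Y T"
      unfolding hs_inner_sum[OF add_carrier_mat[OF XY(2)] T] hs_inner_sum[OF XY(1) T]
        hs_inner_sum[OF XY(2) T]
      using XY(1,2) by (simp add: sum.distrib distrib_right)
    then show "X \<oplus>\<^bsub>V\<^esub> Y \<in> ?N"
      using XY by (simp add: module_mat_simps)
  next
    fix X and c :: complex assume "X \<in> ?N"
    then have X: "X \<in> carrier_mat n n" "hs_inner X T = 0"
      by auto
    have "hs_inner (c \<cdot>\<^sub>m X) T = cnj c * hs_inner X T"
      unfolding hs_inner_sum[OF smult_carrier_mat[OF X(1)] T] hs_inner_sum[OF X(1) T]
      using X(1) by (simp add: sum_distrib_left mult_ac)
    then show "c \<odot>\<^bsub>V\<^esub> X \<in> ?N"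
      using X by (simp add: module_mat_simps)
  qed (auto simp: module_mat_simps hs_inner_sum[OF zero_carrier_mat T])
  then have "span G \<subseteq> ?N"
    using G assms(3) by (intro span_is_subset) auto
  then show ?thesis
    using T by (auto simp: hs_perp_def)
qed

section \<open>Tensor products and orthogonal complements\<close>

lemma kron_carrier [simp]:
  "X \<in> carrier_mat a a \<Longrightarrow> Y \<in> carrier_mat b b \<Longrightarrow> kron X Y \<in> carrier_mat (a * b) (a * b)"
  unfolding kron_def by auto

lemma tensor_full_mono: "S \<subseteq> S' \<Longrightarrow> tensor_full d S n \<subseteq> tensor_full d S' n"
proof -
  assume "S \<subseteq> S'"
  interpret matrix_vs "d * n" "d * n" "TYPE(complex)" .
  show ?thesis
    unfolding tensor_full_def using \<open>S \<subseteq> S'\<close> by (intro span_is_monotone) auto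
qed

lemma tensor_full_carrier:
  assumes "S \<subseteq> carrier_mat d d"
  shows "tensor_full d S n \<subseteq> carrier_mat (d * n) (d * n)"
proof -
  interpret matrix_vs "d * n" "d * n" "TYPE(complex)" .
  have "{kron X Y | X Y. X \<in> S \<and> Y \<in> carrier_mat n n} \<subseteq> carrier_mat (d * n) (d * n)"
    using assms by auto
  then show ?thesis
    unfolding tensor_full_def by (rule span_is_subset2)
qed

lemma hs_perp_zero: "S \<subseteq> carrier_mat n n \<Longrightarrow> 0\<^sub>m n n \<in> hs_perp n S"
  by (auto simp: hs_perp_def hs_inner_sum)

text \<open>Carries the orthogonality assumed for \<open>\<rho>\<close> over to
  \<open>\<rho> / l\<close>.\<close>

lemma hs_perp_smult:
  assumes "S \<subseteq> carrier_mat n n" "T \<in> hs_perp n S"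
  shows "c \<cdot>\<^sub>m T \<in> hs_perp n S"
proof -
  have T: "T \<in> carrier_mat n n"
    using assms by (simp add: hs_perp_def)
  have "hs_inner X (c \<cdot>\<^sub>m T) = c * hs_inner X T" if "X \<in> S" for X
  proof -
    have X: "X \<in> carrier_mat n n"
      using that assms by auto
    show ?thesis
      unfolding hs_inner_sum[OF X smult_carrier_mat[OF T]] hs_inner_sum[OF X T]
      using T by (simp add: sum_distrib_left mult_ac)
  qed
  then show ?thesis
    using assms by (simp add: hs_perp_def)
qed

lemma kron_in_tensor_full:
  assumes "S \<subseteq> carrier_mat d d" "X \<in> S" "Y \<in> carrier_mat n n"
  shows "kron X Y \<in> tensor_full d S n"
proof -
  interpret matrix_vs "d * n" "d * n" "TYPE(complex)" .
  let ?G = "{kron X Y | X Y. X \<in> S \<and> Y \<in> carrier_mat n n}"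
  have "?G \<subseteq> carrier_mat (d * n) (d * n)"
    using assms(1) by auto
  then have "?G \<subseteq> span ?G"
    by (rule in_own_span)
  then show ?thesis
    unfolding tensor_full_def using assms by blast
qed

lemma theta_antimono: "S \<subseteq> S' \<Longrightarrow> theta d S' \<le> theta d S"
  unfolding theta_def hs_perp_def by (intro SUP_subset_mono) auto

lemma theta_quantum_antimono: "S \<subseteq> S' \<Longrightarrow> theta_quantum d S' \<le> theta_quantum d S"
  unfolding theta_quantum_def by (intro SUP_mono') (simp add: theta_antimono tensor_full_mono)


section \<open>Block operators\<close>

text \<open>The index \<open>p * N + m\<close> stands for \<open>e\<^sub>p \<otimes> e\<^sub>m\<close>, and \<open>B m m'\<close> is the block
  of the operator at \<open>|m\<rangle>\<langle>m'|\<close>, the second tensor factor being \<open>\<complex>\<^sup>N\<close>.\<close>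

definition block_op :: "nat \<Rightarrow> nat \<Rightarrow> (nat \<Rightarrow> nat \<Rightarrow> complex mat) \<Rightarrow> complex mat" where
  "block_op D N B = mat (D * N) (D * N) (\<lambda>(i, j). B (i mod N) (j mod N) $$ (i div N, j div N))"

text \<open>The vectors \<open>x m\<close> in the decomposition of \<open>u\<close> as the sum of
  the \<open>x m \<otimes> e\<^sub>m\<close>.\<close>

definition slice :: "nat \<Rightarrow> nat \<Rightarrow> complex vec \<Rightarrow> nat \<Rightarrow> complex vec" where
  "slice D N u m = vec D (\<lambda>p. u $ (p * N + m))"

lemma block_op_carrier [simp]: "block_op D N B \<in> carrier_mat (D * N) (D * N)"
  by (simp add: block_op_def)

lemma slice_carrier [simp]: "slice D N u m \<in> carrier_vec D"
  by (simp add: slice_def)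

lemma block_index_less:
  fixes p m :: nat
  assumes "p < D" "m < N"
  shows "p * N + m < D * N"
proof -
  have "p * N + m < Suc p * N"
    using assms by simp
  also have "\<dots> \<le> D * N"
    using assms by (intro mult_le_mono1) simp
  finally show ?thesis .
qed

lemma block_op_index:
  assumes "p < D" "q < D" "m < N" "m' < N"
  shows "block_op D N B $$ (p * N + m, q * N + m') = B m m' $$ (p, q)"
  using assms block_index_less[of p D m N] block_index_less[of q D m' N]
  by (simp add: block_op_def)

lemma form_block_op:
  assumes B: "\<And>m m'. m < N \<Longrightarrow> m' < N \<Longrightarrow> B m m' \<in> carrier_mat D D"
    and u: "u \<in> carrier_vec (D * N)" and w: "w \<in> carrier_vec (D * N)"
  shows "(block_op D N B *\<^sub>v u) \<bullet>c w =
    (\<Sum>m<N. \<Sum>m'<N. (B m m' *\<^sub>v slice D N u m') \<bullet>c slice D N w m)"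
proof -
  have "(block_op D N B *\<^sub>v u) \<bullet>c w = (\<Sum>m<N. \<Sum>p<D. \<Sum>m'<N. \<Sum>q<D.
      B m m' $$ (p, q) * u $ (q * N + m') * cnj (w $ (p * N + m)))"
    unfolding form_sum[OF block_op_carrier u w] sum_nat_blocks
    by (intro sum.cong refl) (simp add: block_op_index)
  also have "\<dots> = (\<Sum>m<N. \<Sum>m'<N. \<Sum>p<D. \<Sum>q<D.
      B m m' $$ (p, q) * u $ (q * N + m') * cnj (w $ (p * N + m)))"
    by (rule sum.cong[OF refl], rule sum.swap)
  also have "\<dots> = (\<Sum>m<N. \<Sum>m'<N. (B m m' *\<^sub>v slice D N u m') \<bullet>c slice D N w m)"
    by (intro sum.cong refl, subst form_sum[where n = D and k = D]) (auto simp: B slice_def)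
  finally show ?thesis .
qed

lemma cscalar_prod_slices:
  assumes "w \<in> carrier_vec (D * N)"
  shows "u \<bullet>c w = (\<Sum>m<N. slice D N u m \<bullet>c slice D N w m)"
  unfolding cscalar_prod_sum[OF assms] sum_nat_blocks cscalar_prod_sum[OF slice_carrier]
  by (simp add: slice_def)

text \<open>Both bracketings of \<open>\<complex>\<^sup>d \<otimes> \<complex>\<^sup>r \<otimes>
  \<complex>\<^sup>N\<close> number the basis alike, so \<open>kron X Y\<close> is itself a block
  operator: its blocks are the tensor products of \<open>X\<close> with the \<open>r\<close> by
  \<open>r\<close> blocks of \<open>Y\<close>.\<close>

lemma hs_inner_kron_block_op:
  assumes X: "X \<in> carrier_mat d d" and Y: "Y \<in> carrier_mat (r * N) (r * N)"
    and B: "\<And>m m'. m < N \<Longrightarrow> m' < N \<Longrightarrow> B m m' \<in> carrier_mat (d * r) (d * r)"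
  shows "hs_inner (kron X Y) (block_op (d * r) N B) =
    (\<Sum>m<N. \<Sum>m'<N. hs_inner (kron X (mat r r (\<lambda>(a, b). Y $$ (a * N + m, b * N + m')))) (B m m'))"
proof -
  let ?Y = "\<lambda>m m'. mat r r (\<lambda>(a, b). Y $$ (a * N + m, b * N + m'))"
  let ?D = "d * r"
  have Ym: "?Y m m' \<in> carrier_mat r r" for m m'
    by simp
  have K: "kron X Y \<in> carrier_mat (?D * N) (?D * N)"
    using kron_carrier[OF X Y] by (simp add: mult.assoc)
  \<comment> \<open>For \<open>p = i * r + a\<close> with \<open>a < r\<close>, the index
    \<open>p * N + m\<close> is \<open>i * (r * N) + (a * N + m)\<close>.\<close>
  have idx: "(p * N + m) div (r * N) = p div r" "(p * N + m) mod (r * N) = (p mod r) * N + m"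
    if "m < N" for p m
    using that by (auto simp: mult.commute[of r N] mult.commute[of p N]
        mult.commute[of "p mod r" N] div_mult2_eq mod_mult2_eq)
  have ent: "kron X Y $$ (p * N + m, q * N + m') = kron X (?Y m m') $$ (p, q)"
    if "p < ?D" "q < ?D" "m < N" "m' < N" for p q m m'
  proof -
    have "p * N + m < d * (r * N)" "q * N + m' < d * (r * N)"
      using block_index_less[OF that(1,3)] block_index_less[OF that(2,4)]
      by (simp_all add: mult.assoc)
    moreover have "0 < r"
      using that by (cases r) auto
    ultimately show ?thesis
      using X Y that unfolding kron_def by (simp add: idx)
  qed
  have "hs_inner (kron X Y) (block_op ?D N B) = (\<Sum>m<N. \<Sum>p<?D. \<Sum>m'<N. \<Sum>q<?D.
      cnj (kron X (?Y m m') $$ (p, q)) * B m m' $$ (p, q))"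
    unfolding hs_inner_sum[OF K block_op_carrier] sum_nat_blocks[where D = ?D and N = N]
    by (intro sum.cong refl) (simp add: block_op_index ent)
  also have "\<dots> = (\<Sum>m<N. \<Sum>m'<N. \<Sum>p<?D. \<Sum>q<?D.
      cnj (kron X (?Y m m') $$ (p, q)) * B m m' $$ (p, q))"
    by (rule sum.cong[OF refl], rule sum.swap)
  also have "\<dots> = (\<Sum>m<N. \<Sum>m'<N. hs_inner (kron X (?Y m m')) (B m m'))"
    by (intro sum.cong refl) (simp add: hs_inner_sum[OF kron_carrier[OF X Ym] B])
  finally show ?thesis .
qed

text \<open>Against a generator \<open>kron X Y\<close> the inner product splits into terms pairing
  \<open>B m m'\<close> with \<open>kron X Z\<close>, where \<open>Z\<close> is a block of
  \<open>Y\<close>; each term vanishes because \<open>kron X Z\<close> lies in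
  \<open>tensor_full d S r\<close>.\<close>

lemma block_op_in_hs_perp:
  assumes S: "S \<subseteq> carrier_mat d d"
    and B: "\<And>m m'. m < N \<Longrightarrow> m' < N \<Longrightarrow> B m m' \<in> hs_perp (d * r) (tensor_full d S r)"
  shows "block_op (d * r) N B \<in> hs_perp (d * (r * N)) (tensor_full d S (r * N))"
  unfolding tensor_full_def
proof (rule hs_perp_spanI)
  show "block_op (d * r) N B \<in> carrier_mat (d * (r * N)) (d * (r * N))"
    using block_op_carrier[of "d * r" N B] by (simp add: mult.assoc)
  show "{kron X Y |X Y. X \<in> S \<and> Y \<in> carrier_mat (r * N) (r * N)}
      \<subseteq> carrier_mat (d * (r * N)) (d * (r * N))"
    using S by auto
  fix K assume "K \<in> {kron X Y |X Y. X \<in> S \<and> Y \<in> carrier_mat (r * N) (r * N)}"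
  then obtain X Y where K: "K = kron X Y" "X \<in> S" and Y: "Y \<in> carrier_mat (r * N) (r * N)"
    by blast
  have X: "X \<in> carrier_mat d d"
    using K S by auto
  have C: "B m m' \<in> carrier_mat (d * r) (d * r)" if "m < N" "m' < N" for m m'
    using B[OF that] by (simp add: hs_perp_def)
  have "hs_inner (kron X Z) (B m m') = 0" if "m < N" "m' < N" "Z \<in> carrier_mat r r" for m m' Z
    using B[OF that(1,2)] kron_in_tensor_full[OF S K(2) that(3)] by (simp add: hs_perp_def)
  then show "hs_inner K (block_op (d * r) N B) = 0"
    unfolding K(1) by (subst hs_inner_kron_block_op[OF X Y]) (auto simp: C)
qed

text \<open>An entry is on the diagonal iff the quotients and the remainders of its indices by
  \<open>N\<close> agree, so the identity fills exactly the diagonal blocks.\<close>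

lemma one_plus_block_op:
  assumes "\<And>m m'. m < N \<Longrightarrow> m' < N \<Longrightarrow> m \<noteq> m' \<Longrightarrow> C m m' \<in> carrier_mat D D"
  shows "1\<^sub>m (D * N) + block_op D N (\<lambda>m m'. if m = m' then 0\<^sub>m D D else C m m')
    = block_op D N (\<lambda>m m'. if m = m' then 1\<^sub>m D else C m m')"
proof (rule eq_matI)
  fix i j
  assume "i < dim_row (block_op D N (\<lambda>m m'. if m = m' then 1\<^sub>m D else C m m'))"
    "j < dim_col (block_op D N (\<lambda>m m'. if m = m' then 1\<^sub>m D else C m m'))"
  then have ij: "i < D * N" "j < D * N"
    by (auto simp: block_op_def)
  then have "i div N < D" "j div N < D"
    by (auto simp: less_mult_imp_div_less)
  moreover have "i = j \<longleftrightarrow> i div N = j div N \<and> i mod N = j mod N"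
    by (metis div_mult_mod_eq)
  ultimately show "(1\<^sub>m (D * N) + block_op D N (\<lambda>m m'. if m = m' then 0\<^sub>m D D else C m m')) $$ (i, j)
    = block_op D N (\<lambda>m m'. if m = m' then 1\<^sub>m D else C m m') $$ (i, j)"
    using ij by (auto simp: block_op_def)
qed (auto simp: block_op_def)


section \<open>The optimal operator\<close>

lemma psd_carrier: "psd n A \<Longrightarrow> A \<in> carrier_mat n n"
  by (simp add: psd_def)

lemma psd_form_real:
  assumes "psd n A" "v \<in> carrier_vec n"
  shows "(A *\<^sub>v v) \<bullet>c v = of_real (Re ((A *\<^sub>v v) \<bullet>c v))" "0 \<le> Re ((A *\<^sub>v v) \<bullet>c v)"
  using assms by (auto simp: psd_def less_eq_complex_def complex_eq_iff)

lemma vec_norm2_unitary: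
  assumes "unitary_mat n U" "v \<in> carrier_vec n"
  shows "vec_norm2 (U *\<^sub>v v) = vec_norm2 v"
proof -
  have U: "U \<in> carrier_mat n n" "mat_adjoint U * U = 1\<^sub>m n"
    using assms by (auto simp: unitary_mat_def)
  have "(U *\<^sub>v v) \<bullet>c (U *\<^sub>v v) = v \<bullet>c (mat_adjoint U *\<^sub>v (U *\<^sub>v v))"
    using U assms by (intro form_adjoint) auto
  also have "\<dots> = v \<bullet>c v"
    using assms U by (simp flip: assoc_mult_mat_vec[OF mat_adjoint_carrier[OF U(1)] U(1) assms(2)])
  finally show ?thesis
    by (simp add: vec_norm2_def)
qed

lemma vec_norm2_unitary_adjoint:
  assumes "unitary_mat n U" "v \<in> carrier_vec n"
  shows "vec_norm2 (mat_adjoint U *\<^sub>v v) = vec_norm2 v"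
proof -
  have U: "U \<in> carrier_mat n n" "U * mat_adjoint U = 1\<^sub>m n"
    using assms by (auto simp: unitary_mat_def)
  have "mat_adjoint U *\<^sub>v v \<in> carrier_vec n"
    using mat_adjoint_carrier[OF U(1)] assms(2) by (rule mult_mat_vec_carrier)
  then have "vec_norm2 (mat_adjoint U *\<^sub>v v) = vec_norm2 (U *\<^sub>v (mat_adjoint U *\<^sub>v v))"
    using vec_norm2_unitary[OF assms(1)] by simp
  also have "\<dots> = vec_norm2 v"
    using assms U by (simp flip: assoc_mult_mat_vec[OF U(1) mat_adjoint_carrier[OF U(1)] assms(2)])
  finally show ?thesis .
qed

text \<open>The operator \<open>1 + T\<close>, with the identity already entered in the diagonal
  blocks; \<open>R\<close> stands for the rescaled state.\<close>

definition code_op :: "nat \<Rightarrow> nat \<Rightarrow> complex mat \<Rightarrow> (nat \<Rightarrow> complex mat) \<Rightarrow> complex mat" where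
  "code_op D N R U = block_op D N (\<lambda>m m'. if m = m' then 1\<^sub>m D else U m * R * mat_adjoint (U m'))"

text \<open>The diagonal blocks are \<open>1 = U\<^sub>m R U\<^sub>m\<^sup>\<dagger> + U\<^sub>m (1 - R) U\<^sub>m\<^sup>\<dagger>\<close>, which splits the operator into
  a part built from \<open>R\<close> alone and a block diagonal part.\<close>

lemma form_code_op:
  assumes R: "R \<in> carrier_mat D D"
    and U: "\<And>m. m < N \<Longrightarrow> unitary_mat D (U m)"
    and u: "u \<in> carrier_vec (D * N)"
    and y: "\<And>m. m < N \<Longrightarrow> y m = mat_adjoint (U m) *\<^sub>v slice D N u m"
  shows "(code_op D N R U *\<^sub>v u) \<bullet>c u =
    (\<Sum>m<N. of_real ((vec_norm2 (y m))\<^sup>2) - (R *\<^sub>v y m) \<bullet>c y m) +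
    (R *\<^sub>v vec D (\<lambda>p. \<Sum>m<N. y m $ p)) \<bullet>c vec D (\<lambda>p. \<Sum>m<N. y m $ p)"
proof -
  let ?s = "slice D N u"
  have Uc: "U m \<in> carrier_mat D D" if "m < N" for m
    using U[OF that] by (simp add: unitary_mat_def)
  note Ua = mat_adjoint_carrier[OF Uc]
  have yc: "y m \<in> carrier_vec D" if "m < N" for m
    unfolding y[OF that] using Ua[OF that] slice_carrier by (rule mult_mat_vec_carrier)
  have UR: "U m * R * mat_adjoint (U m') \<in> carrier_mat D D" if "m < N" "m' < N" for m m'
    using Uc[OF that(1)] R Ua[OF that(2)] by simp
  \<comment> \<open>The outer unitaries are absorbed into the two arguments of the form, leaving
    only \<open>R\<close>.\<close>
  have off: "((U m * R * mat_adjoint (U m')) *\<^sub>v ?s m') \<bullet>c ?s m = (R *\<^sub>v y m') \<bullet>c y m"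
    if "m < N" "m' < N" for m m'
  proof -
    have "(U m * R * mat_adjoint (U m')) *\<^sub>v ?s m' = U m *\<^sub>v (R *\<^sub>v y m')"
      using Uc[OF that(1)] R Ua[OF that(2)] yc[OF that(2)]
      by (simp add: assoc_mult_mat_vec[of _ D D _ D] y[OF that(2)])
    moreover have "(U m *\<^sub>v (R *\<^sub>v y m')) \<bullet>c ?s m = (R *\<^sub>v y m') \<bullet>c y m"
      unfolding y[OF that(1)]
      using Uc[OF that(1)] mult_mat_vec_carrier[OF R yc[OF that(2)]] slice_carrier
      by (rule form_adjoint)
    ultimately show ?thesis
      by simp
  qed
  have diag: "(1\<^sub>m D *\<^sub>v ?s m) \<bullet>c ?s m = of_real ((vec_norm2 (y m))\<^sup>2)" if "m < N" for m
    by (simp add: cscalar_prod_self[OF slice_carrier] y[OF that]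
        vec_norm2_unitary_adjoint[OF U[OF that] slice_carrier])
  have "(code_op D N R U *\<^sub>v u) \<bullet>c u = (\<Sum>m<N. \<Sum>m'<N.
      ((if m = m' then 1\<^sub>m D else U m * R * mat_adjoint (U m')) *\<^sub>v ?s m') \<bullet>c ?s m)"
    unfolding code_op_def using UR u by (intro form_block_op) auto
  \<comment> \<open>The diagonal term of \<open>R\<close> is added and subtracted, so that the
    double sum runs over all pairs.\<close>
  also have "\<dots> = (\<Sum>m<N. \<Sum>m'<N. (R *\<^sub>v y m') \<bullet>c y m +
      (if m = m' then of_real ((vec_norm2 (y m))\<^sup>2) - (R *\<^sub>v y m) \<bullet>c y m else 0))"
    by (intro sum.cong refl) (auto simp: off diag simp del: one_mult_mat_vec)
  also have "\<dots> = (\<Sum>m<N. of_real ((vec_norm2 (y m))\<^sup>2) - (R *\<^sub>v y m) \<bullet>c y m) +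
      (\<Sum>m<N. \<Sum>m'<N. (R *\<^sub>v y m') \<bullet>c y m)"
    by (simp add: sum.distrib)
  also have "(\<Sum>m<N. \<Sum>m'<N. (R *\<^sub>v y m') \<bullet>c y m) =
      (R *\<^sub>v vec D (\<lambda>p. \<Sum>m<N. y m $ p)) \<bullet>c vec D (\<lambda>p. \<Sum>m<N. y m $ p)"
    unfolding form_sum_vec[OF R] by (intro sum.cong refl) (simp add: form_sum[OF R] yc)
  finally show ?thesis .
qed

text \<open>By \<open>form_code_op\<close> the form is a sum of values of \<open>1 - R\<close> plus
  one value of \<open>R\<close>. Since \<open>le\<close> says \<open>R \<le> 1\<close>, both parts
  are nonnegative.\<close>

lemma psd_code_op:
  assumes R: "psd D R" and le: "\<And>v. v \<in> carrier_vec D \<Longrightarrow> Re ((R *\<^sub>v v) \<bullet>c v) \<le> (vec_norm2 v)\<^sup>2"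
    and U: "\<And>m. m < N \<Longrightarrow> unitary_mat D (U m)"
  shows "psd (D * N) (code_op D N R U)"
  unfolding psd_def
proof (intro conjI ballI)
  show "code_op D N R U \<in> carrier_mat (D * N) (D * N)"
    by (simp add: code_op_def)
  fix u :: "complex vec" assume u: "u \<in> carrier_vec (D * N)"
  define y where "y = (\<lambda>m. mat_adjoint (U m) *\<^sub>v slice D N u m)"
  have y: "y m = mat_adjoint (U m) *\<^sub>v slice D N u m" if "m < N" for m
    by (simp add: y_def)
  have yc: "y m \<in> carrier_vec D" if "m < N" for m
    unfolding y_def using U[OF that]
    by (meson mat_adjoint_carrier mult_mat_vec_carrier slice_carrier unitary_mat_def)
  have "0 \<le> of_real ((vec_norm2 (y m))\<^sup>2) - (R *\<^sub>v y m) \<bullet>c y m" if "m < N" for m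
    using psd_form_real[OF R yc[OF that]] le[OF yc[OF that]]
    by (auto simp: less_eq_complex_def complex_eq_iff)
  then have "0 \<le> (\<Sum>m<N. of_real ((vec_norm2 (y m))\<^sup>2) - (R *\<^sub>v y m) \<bullet>c y m)"
    by (intro sum_nonneg) auto
  moreover have "0 \<le> (R *\<^sub>v vec D (\<lambda>p. \<Sum>m<N. y m $ p)) \<bullet>c vec D (\<lambda>p. \<Sum>m<N. y m $ p)"
    using R by (auto simp: psd_def)
  ultimately show "0 \<le> (code_op D N R U *\<^sub>v u) \<bullet>c u"
    using form_code_op[where y = y, OF psd_carrier[OF R] U u y]
    by (simp only:) (rule add_nonneg_nonneg)
qed

text \<open>For the test vector below all \<open>y m\<close> equal \<open>v\<close>. With
  \<open>q\<close> the Rayleigh quotient of \<open>R\<close> at \<open>v\<close>, the form is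
  \<open>N * (1 - q) + N * N * q\<close>, while the squared norm is \<open>N\<close>. At an
  eigenvector with eigenvalue 1 the bound becomes \<open>N\<close>.\<close>

lemma op_norm_code_op_ge:
  assumes R: "R \<in> carrier_mat D D" and U: "\<And>m. m < N \<Longrightarrow> unitary_mat D (U m)"
    and v: "v \<in> carrier_vec D" "vec_norm2 v = 1" and "0 < N"
  shows "1 + (real N - 1) * Re ((R *\<^sub>v v) \<bullet>c v) \<le> op_norm (code_op D N R U)"
proof -
  \<comment> \<open>The sum of the \<open>(U m *\<^sub>v v) \<otimes> e\<^sub>m\<close>: the block
    diagonal unitary applied to \<open>v\<close> tensored with the all-ones vector.\<close>
  define u where "u = vec (D * N) (\<lambda>i. (U (i mod N) *\<^sub>v v) $ (i div N))"
  let ?q = "(R *\<^sub>v v) \<bullet>c v"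
  have u: "u \<in> carrier_vec (D * N)"
    by (simp add: u_def)
  have Uc: "U m \<in> carrier_mat D D" "mat_adjoint (U m) * U m = 1\<^sub>m D" if "m < N" for m
    using U[OF that] by (auto simp: unitary_mat_def)
  have slice: "slice D N u m = U m *\<^sub>v v" if "m < N" for m
    using Uc(1)[OF that] block_index_less[OF _ that, of _ D] that
    by (intro eq_vecI) (auto simp: slice_def u_def simp del: index_mult_mat_vec)
  have y: "v = mat_adjoint (U m) *\<^sub>v slice D N u m" if "m < N" for m
    using Uc[OF that] v
    by (simp add: slice[OF that] flip: assoc_mult_mat_vec[OF mat_adjoint_carrier[OF Uc(1)[OF that]] Uc(1)[OF that] v(1)])
  have "u \<bullet>c u = (\<Sum>m<N. 1)"
    unfolding cscalar_prod_slices[OF u]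
    by (intro sum.cong refl)
       (simp add: slice cscalar_prod_self[OF mult_mat_vec_carrier[OF Uc(1) v(1)]] vec_norm2_unitary[OF U v(1)] v(2))
  then have nu: "(vec_norm2 u)\<^sup>2 = N"
    by (simp add: vec_norm2_def)
  \<comment> \<open>The \<open>N\<close> equal vectors add up coherently, which produces the factor
    \<open>N * N\<close> in front of \<open>?q\<close>.\<close>
  have "vec D (\<lambda>p. \<Sum>m<N. v $ p) = of_nat N \<cdot>\<^sub>v v"
    using v by (intro eq_vecI) auto
  then have eq: "(code_op D N R U *\<^sub>v u) \<bullet>c u = (\<Sum>m<N. 1 - ?q) + of_nat N * of_nat N * ?q"
    using form_code_op[where y = "\<lambda>_. v", OF R U u y] v(2) by (simp add: form_smult_vec[OF R v(1)])
  have "Re ((code_op D N R U *\<^sub>v u) \<bullet>c u) = N * (1 + (real N - 1) * Re ?q)"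
    unfolding eq by (simp add: algebra_simps)
  moreover have "Re ((code_op D N R U *\<^sub>v u) \<bullet>c u) \<le> op_norm (code_op D N R U) * (vec_norm2 u)\<^sup>2"
  proof (rule Rayleigh_quotient_le_op_norm[OF _ u])
    show "code_op D N R U \<in> carrier_mat (D * N) (D * N)"
      by (simp add: code_op_def)
    have "vec_norm2 u \<noteq> 0"
      using nu \<open>0 < N\<close> by (intro notI) simp
    then show "0 < vec_norm2 u"
      using vec_norm2_nonneg[OF u] by linarith
  qed
  ultimately show ?thesis
    using \<open>0 < N\<close> by (simp add: nu mult.commute)
qed

text \<open>\<open>l\<close> is the largest eigenvalue of \<open>\<rho>\<close>. Being the least upper bound of the Rayleigh quotients
  is all that is used of it, so no eigenvector has to be produced.\<close>

lemma density_op_Rayleigh_Sup: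
  assumes "density_op D \<rho>"
  obtains l where "0 < l"
    and "\<And>v. v \<in> carrier_vec D \<Longrightarrow> Re ((\<rho> *\<^sub>v v) \<bullet>c v) \<le> l * (vec_norm2 v)\<^sup>2"
    and "\<And>c. (\<And>v. v \<in> carrier_vec D \<Longrightarrow> vec_norm2 v = 1 \<Longrightarrow> Re ((\<rho> *\<^sub>v v) \<bullet>c v) \<le> c) \<Longrightarrow> l \<le> c"
proof
  let ?q = "\<lambda>v. Re ((\<rho> *\<^sub>v v) \<bullet>c v)"
  let ?W = "{v \<in> carrier_vec D. vec_norm2 v = 1}"
  let ?l = "SUP v\<in>?W. ?q v"
  have rho: "\<rho> \<in> carrier_mat D D" and tr: "(\<Sum>i<D. \<rho> $$ (i, i)) = 1"
    using assms by (auto simp: density_op_def psd_def mat_trace_def)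
  have bdd: "bdd_above (?q ` ?W)"
    using Rayleigh_quotient_le_op_norm[OF rho] by (intro bdd_aboveI2[of _ _ "op_norm \<rho>"]) fastforce
  \<comment> \<open>Rayleigh quotients at basis vectors are diagonal entries, which brings in the
    trace.\<close>
  have unit: "unit_vec D i \<in> ?W" "?q (unit_vec D i) = Re (\<rho> $$ (i, i))" if "i < D" for i
  proof -
    let ?e = "unit_vec D i :: complex vec"
    have "?e \<bullet>c ?e = (\<Sum>j<D. if j = i then 1 else 0)"
      unfolding cscalar_prod_sum[OF unit_vec_carrier] using that by (intro sum.cong) auto
    then show "?e \<in> ?W"
      using that by (simp add: vec_norm2_def)
    have "(\<rho> *\<^sub>v ?e) \<bullet>c ?e = (\<Sum>j<D. \<Sum>k<D. if k = i then if j = i then \<rho> $$ (j, k) else 0 else 0)"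
      unfolding form_sum[OF rho unit_vec_carrier unit_vec_carrier]
      using that by (intro sum.cong refl) auto
    also have "\<dots> = \<rho> $$ (i, i)"
      using that by simp
    finally show "?q ?e = Re (\<rho> $$ (i, i))"
      by simp
  qed
  have D: "0 < D"
    using tr by (cases D) auto
  \<comment> \<open>The trace is 1 and at most \<open>D\<close> times \<open>?l\<close>, which
    forces \<open>?l\<close> to be positive.\<close>
  have "1 = (\<Sum>i<D. Re (\<rho> $$ (i, i)))"
    using arg_cong[OF tr, of Re] by simp
  also have "\<dots> \<le> (\<Sum>i<D. ?l)"
  proof (rule sum_mono)
    fix i assume "i \<in> {..<D}"
    then show "Re (\<rho> $$ (i, i)) \<le> ?l"
      using cSUP_upper[OF unit(1) bdd, of i] unit(2)[of i] by simp
  qed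
  finally have "0 < real D * ?l"
    by simp
  then show pos: "0 < ?l"
    by (simp add: zero_less_mult_iff)
  show "?l \<le> c" if "\<And>v. v \<in> carrier_vec D \<Longrightarrow> vec_norm2 v = 1 \<Longrightarrow> ?q v \<le> c" for c
  proof (rule cSUP_least)
    show "?W \<noteq> {}"
      using unit(1)[OF D] by blast
  qed (use that in auto)
  fix v :: "complex vec" assume v: "v \<in> carrier_vec D"
  show "?q v \<le> ?l * (vec_norm2 v)\<^sup>2"
  proof (cases "vec_norm2 v = 0")
    case True
    then have "v = 0\<^sub>v D"
      using cscalar_prod_self[OF v] v by simp
    then show ?thesis
      using rho True by simp
  next
    case False
    let ?c = "complex_of_real (1 / vec_norm2 v)"
    have c: "?c * cnj ?c = of_real (1 / (vec_norm2 v)\<^sup>2)"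
      by (simp add: power2_eq_square)
    have "(?c \<cdot>\<^sub>v v) \<bullet>c (?c \<cdot>\<^sub>v v) = 1"
      using False unfolding cscalar_prod_smult[OF v] cscalar_prod_self[OF v]
      by (simp add: power2_eq_square)
    then have "?c \<cdot>\<^sub>v v \<in> ?W"
      using v by (simp add: vec_norm2_def)
    then have "?q (?c \<cdot>\<^sub>v v) \<le> ?l"
      using bdd by (rule cSUP_upper)
    then have "?q v / (vec_norm2 v)\<^sup>2 \<le> ?l"
      unfolding form_smult_vec[OF rho v] c by simp
    then show ?thesis
      using False by (simp add: field_simps)
  qed
qed

section \<open>Comparison with the quantum Lovasz function\<close>

lemma op_norm_le_theta_quantum:
  assumes "T \<in> hs_perp (d * n) (tensor_full d S n)" "psd (d * n) (1\<^sub>m (d * n) + T)" "0 < n"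
  shows "ereal (op_norm (1\<^sub>m (d * n) + T)) \<le> theta_quantum d S"
proof -
  have "ereal (op_norm (1\<^sub>m (d * n) + T)) \<le> theta (d * n) (tensor_full d S n)"
    unfolding theta_def using assms by (intro SUP_upper) auto
  also have "\<dots> \<le> theta_quantum d S"
    unfolding theta_quantum_def using assms by (intro SUP_upper) auto
  finally show ?thesis .
qed


text \<open>Follows from \<open>T = 0\<close>. It settles \<open>N = 0\<close> and the case in which
  no \<open>N\<close> is admissible.\<close>

lemma theta_quantum_nonneg:
  assumes "S \<subseteq> carrier_mat d d"
  shows "0 \<le> theta_quantum d S"
proof -
  let ?A = "1\<^sub>m (d * 1) + 0\<^sub>m (d * 1) (d * 1) :: complex mat"
  have A: "?A \<in> carrier_mat (d * 1) (d * 1)"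
    by simp
  \<comment> \<open>Testing at the zero vector also works for \<open>d = 0\<close>, where there is
    no unit vector.\<close>
  have "0 \<le> vec_norm2 (?A *\<^sub>v 0\<^sub>v (d * 1))"
    by (rule vec_norm2_nonneg[OF mult_mat_vec_carrier[OF A]]) simp
  also have "\<dots> \<le> op_norm ?A"
    by (intro vec_norm2_le_op_norm[OF A]) (auto simp: vec_norm2_def)
  finally have "0 \<le> ereal (op_norm ?A)"
    by simp
  also have "\<dots> \<le> theta_quantum d S"
    using hs_perp_zero[OF tensor_full_carrier[OF assms, of 1]]
    by (intro op_norm_le_theta_quantum) (auto simp: psd_def)
  finally show ?thesis .
qed

text \<open>The witness for \<open>theta_quantum\<close> lives at \<open>n = r * N\<close>. Each
  Rayleigh quotient \<open>q\<close> of \<open>\<rho>\<close> bounds its norm below by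
  \<open>1 + (N - 1) * q / l\<close>, and the supremum over \<open>q\<close> replaces
  \<open>q / l\<close> by 1.\<close>

lemma ea_independent_le_theta_quantum:
  assumes S: "S \<subseteq> carrier_mat d d" and "ea_independent d S N" and "0 < N"
  shows "ereal (real N) \<le> theta_quantum d S"
proof -
  obtain r \<rho> U where rho: "density_op (d * r) \<rho>"
    and U: "\<And>m. m < N \<Longrightarrow> unitary_mat (d * r) (U m)"
    and perp: "\<And>m m'. m < N \<Longrightarrow> m' < N \<Longrightarrow> m \<noteq> m' \<Longrightarrow>
      U m * \<rho> * mat_adjoint (U m') \<in> hs_perp (d * r) (tensor_full d S r)"
    using assms(2) unfolding ea_independent_def by blast
  let ?D = "d * r"
  from rho obtain l where l: "0 < l"
      "\<And>v. v \<in> carrier_vec ?D \<Longrightarrow> Re ((\<rho> *\<^sub>v v) \<bullet>c v) \<le> l * (vec_norm2 v)\<^sup>2"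
    and l_le: "\<And>c. (\<And>v. v \<in> carrier_vec ?D \<Longrightarrow> vec_norm2 v = 1 \<Longrightarrow>
        Re ((\<rho> *\<^sub>v v) \<bullet>c v) \<le> c) \<Longrightarrow> l \<le> c"
    by (rule density_op_Rayleigh_Sup) blast
  have psd: "psd ?D \<rho>"
    using rho by (simp add: density_op_def)
  note rho_carrier = psd_carrier[OF psd]
  \<comment> \<open>For \<open>r = 0\<close> the trace would be an empty sum. Positivity of
    \<open>r * N\<close> is needed because \<open>theta_quantum\<close> ranges over
    \<open>n \<ge> 1\<close>.\<close>
  have "0 < r"
    using rho by (cases r) (auto simp: density_op_def psd_def mat_trace_def)
  \<comment> \<open>The largest rescaling of \<open>\<rho>\<close> that stays below the
    identity.\<close>
  let ?R = "complex_of_real (1 / l) \<cdot>\<^sub>m \<rho>"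
  have R: "?R \<in> carrier_mat ?D ?D"
    using rho_carrier by simp
  have R_form: "(?R *\<^sub>v v) \<bullet>c v = of_real (1 / l) * ((\<rho> *\<^sub>v v) \<bullet>c v)" if "v \<in> carrier_vec ?D" for v
    by (rule form_smult_mat[OF rho_carrier that that])
  have Re_R: "Re ((?R *\<^sub>v v) \<bullet>c v) = Re ((\<rho> *\<^sub>v v) \<bullet>c v) / l" if "v \<in> carrier_vec ?D" for v
    unfolding R_form[OF that] by simp
  have "psd ?D ?R"
    unfolding psd_def
  proof (intro conjI ballI R)
    fix v :: "complex vec" assume v: "v \<in> carrier_vec ?D"
    show "0 \<le> (?R *\<^sub>v v) \<bullet>c v"
      unfolding R_form[OF v] using psd_form_real[OF psd v] \<open>0 < l\<close>
      by (intro mult_nonneg_nonneg) (auto simp: less_eq_complex_def complex_eq_iff)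
  qed
  then have psd_code: "psd (?D * N) (code_op ?D N ?R U)"
  proof (rule psd_code_op)
    fix v :: "complex vec" assume v: "v \<in> carrier_vec ?D"
    show "Re ((?R *\<^sub>v v) \<bullet>c v) \<le> (vec_norm2 v)\<^sup>2"
      unfolding Re_R[OF v] using l(1) l(2)[OF v] by (simp add: divide_le_eq mult.commute)
  qed (rule U)
  have Uc: "U m \<in> carrier_mat ?D ?D" if "m < N" for m
    using U[OF that] by (simp add: unitary_mat_def)
  note Ua = mat_adjoint_carrier[OF Uc]
  have scale: "U m * ?R * mat_adjoint (U m') = of_real (1 / l) \<cdot>\<^sub>m (U m * \<rho> * mat_adjoint (U m'))"
    if "m < N" "m' < N" for m m'
    using mult_smult_distrib[OF Uc[OF that(1)] rho_carrier]
      mult_smult_assoc_mat[OF mult_carrier_mat[OF Uc[OF that(1)] rho_carrier] Ua[OF that(2)]]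
    by simp
  let ?T = "block_op ?D N (\<lambda>m m'. if m = m' then 0\<^sub>m ?D ?D else U m * ?R * mat_adjoint (U m'))"
  have "U m * ?R * mat_adjoint (U m') \<in> hs_perp ?D (tensor_full d S r)"
    if "m < N" "m' < N" "m \<noteq> m'" for m m'
    unfolding scale[OF that(1,2)] by (rule hs_perp_smult[OF tensor_full_carrier[OF S] perp[OF that]])
  then have T: "?T \<in> hs_perp (d * (r * N)) (tensor_full d S (r * N))"
    by (intro block_op_in_hs_perp[OF S]) (auto intro: hs_perp_zero[OF tensor_full_carrier[OF S]])
  have T_code: "1\<^sub>m (d * (r * N)) + ?T = code_op ?D N ?R U"
    unfolding code_op_def mult.assoc[symmetric, of d r N]
    by (rule one_plus_block_op)
       (rule mult_carrier_mat[OF mult_carrier_mat[OF Uc R] Ua])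
  let ?K = "op_norm (code_op ?D N ?R U)"
  have ge: "1 + (real N - 1) * (Re ((\<rho> *\<^sub>v v) \<bullet>c v) / l) \<le> ?K"
    if "v \<in> carrier_vec ?D" "vec_norm2 v = 1" for v
    using op_norm_code_op_ge[OF R U that \<open>0 < N\<close>] Re_R[OF that(1)] by simp
  \<comment> \<open>Here \<open>ge\<close> reads \<open>1 \<le> ?K\<close> as soon as a unit vector
    exists. Were it false, there would be no unit vector, and \<open>l_le\<close> would hold
    vacuously with bound 0.\<close>
  have "1 \<le> ?K" if "N = 1"
  proof (rule ccontr)
    assume "\<not> 1 \<le> ?K"
    then have "l \<le> 0"
      using ge \<open>N = 1\<close> by (intro l_le) auto
    then show False
      using \<open>0 < l\<close> by simp
  qed
  moreover have "real N \<le> ?K" if "1 < N"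
  proof -
    \<comment> \<open>The inequality \<open>ge\<close>, solved for the Rayleigh quotient, bounds all
      of them and hence \<open>l\<close>; cancelling \<open>l\<close> gives
      \<open>N - 1 \<le> ?K - 1\<close>.\<close>
    have "l \<le> (?K - 1) * l / (real N - 1)"
    proof (rule l_le)
      fix v assume "v \<in> carrier_vec ?D" "vec_norm2 v = 1"
      from ge[OF this] show "Re ((\<rho> *\<^sub>v v) \<bullet>c v) \<le> (?K - 1) * l / (real N - 1)"
        using that \<open>0 < l\<close> by (simp add: field_simps)
    qed
    then show ?thesis
      using that \<open>0 < l\<close> by (simp add: le_divide_eq mult.commute)
  qed
  ultimately have "real N \<le> ?K"
    using \<open>0 < N\<close> by (cases "N = 1") auto
  then have "ereal (real N) \<le> ereal (op_norm (1\<^sub>m (d * (r * N)) + ?T))"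
    unfolding T_code by simp
  also have "\<dots> \<le> theta_quantum d S"
    using T psd_code \<open>0 < r\<close> \<open>0 < N\<close>
    by (intro op_norm_le_theta_quantum) (auto simp: T_code mult.assoc)
  finally show ?thesis .
qed

lemma alpha_ea_le_theta_quantum:
  assumes S: "S \<subseteq> carrier_mat d d"
  shows "ereal_of_enat (alpha_ea d S) \<le> theta_quantum d S"
proof (cases "{enat N | N. ea_independent d S N} = {}")
  \<comment> \<open>This occurs for \<open>d = 0\<close>, where no density operator exists; the
    supremum of the empty set in \<open>enat\<close> is 0.\<close>
  case True
  then show ?thesis
    unfolding alpha_ea_def True using theta_quantum_nonneg[OF S] by (simp add: bot_enat_def)
next
  case False
  have "ereal_of_enat (enat N) \<le> theta_quantum d S" if "ea_independent d S N" for N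
    using ea_independent_le_theta_quantum[OF S that] theta_quantum_nonneg[OF S]
    by (cases "N = 0") (auto simp: zero_enat_def[symmetric])
  then show ?thesis
    unfolding alpha_ea_def ereal_of_enat_Sup[OF False] by (intro SUP_least) auto
qed

lemma nc_graph_carrier:
  assumes "nc_graph d S"
  shows "S \<subseteq> carrier_mat d d"
proof -
  have "submodule class_ring S (module_mat TYPE(complex) d d)"
    using assms unfolding nc_graph_def VectorSpace.subspace_def by blast
  from submodule.subset[OF this] show ?thesis
    unfolding module_mat_simps .
qed

theorem lemma7:
  fixes d :: nat
  shows "(\<forall>S. nc_graph d S \<longrightarrow> ereal_of_enat (alpha_ea d S) \<le> theta_quantum d S) \<and>
         (\<forall>S S'. nc_graph d S \<longrightarrow> nc_graph d S' \<longrightarrow> S \<subseteq> S' \<longrightarrow>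
            theta_quantum d S' \<le> theta_quantum d S)"
  using alpha_ea_le_theta_quantum[OF nc_graph_carrier] theta_quantum_antimono by blast

end
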